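(* Let $t\ge 3$ be an odd integer, let $T$ be a complete full $t$-ary tree (with at least one edge), and let $l$ be the number of leaves of $T$. Then the local antimagic chromatic number of $T$ is $\chi_{la}(T)=l+1$.
   Context: For an integer $t\ge 2$, a complete full $t$-ary tree is a (finite) rooted tree in which every node other than the leaves has exactly $t$ children and all leaves have the same depth. The leaves are the vertices of degree one, i.e. the nodes without children. (If the common depth is $n\ge 1$, there are $t^n$ leaves.) Let $G=(V,E)$ be a finite simple undirected graph without isolated vertices and without components isomorphic to $K_2$. For a bijection $f:E\to\{1,2,\dots,|E|\}$ and $u\in V$, the vertex sum (weight, color) of $u$ is $w(u)=\sum_{e\in E(u)}f(e)$, where $E(u)$ is the set of edges incident to $u$. The bijection $f$ is called a local antimagic labeling of $G$ if $w(u)\ne w(v)$ for every two adjacent vertices $u,v$. Such an $f$ induces a proper vertex coloring of $G$ in which $v$ receives the color $w(v)$; the number of colors is the number of distinct values of $w$. The local antimagic chromatic number $\chi_{la}(G)$ is the minimum number of colors over all colorings induced by local antimagic labelings of $G$. *)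

theory Defs
  imports Main
begin

(* A graph is given by its vertex set and its set of edges, each edge being the
   unordered pair of its end points. *)

definition simple_graph :: "'a set \<Rightarrow> 'a set set \<Rightarrow> bool" where
  "simple_graph V E \<longleftrightarrow> finite V \<and> (\<forall>e\<in>E. e \<subseteq> V \<and> card e = 2)"

definition incident_edges :: "'a set set \<Rightarrow> 'a \<Rightarrow> 'a set set" where
  "incident_edges E v = {e \<in> E. v \<in> e}"

definition degree :: "'a set set \<Rightarrow> 'a \<Rightarrow> nat" where
  "degree E v = card (incident_edges E v)"

definition walk :: "'a set \<Rightarrow> 'a set set \<Rightarrow> 'a list \<Rightarrow> bool" where
  "walk V E xs \<longleftrightarrow> xs \<noteq> [] \<and> set xs \<subseteq> V \<and> successively (\<lambda>u v. {u, v} \<in> E) xs"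

definition connected_graph :: "'a set \<Rightarrow> 'a set set \<Rightarrow> bool" where
  "connected_graph V E \<longleftrightarrow>
     V \<noteq> {} \<and> (\<forall>u\<in>V. \<forall>v\<in>V. \<exists>xs. walk V E xs \<and> hd xs = u \<and> last xs = v)"

(* A cycle is listed without repeating its first vertex at the end. *)
definition cycle :: "'a set \<Rightarrow> 'a set set \<Rightarrow> 'a list \<Rightarrow> bool" where
  "cycle V E xs \<longleftrightarrow> walk V E xs \<and> distinct xs \<and> 3 \<le> length xs \<and> {last xs, hd xs} \<in> E"

definition tree :: "'a set \<Rightarrow> 'a set set \<Rightarrow> bool" where
  "tree V E \<longleftrightarrow> simple_graph V E \<and> connected_graph V E \<and> (\<nexists>xs. cycle V E xs)"

(* Number of edges of a shortest walk; meaningful only if u and v are connected. *)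
definition graph_dist :: "'a set \<Rightarrow> 'a set set \<Rightarrow> 'a \<Rightarrow> 'a \<Rightarrow> nat" where
  "graph_dist V E u v =
     (LEAST n. \<exists>xs. walk V E xs \<and> hd xs = u \<and> last xs = v \<and> length xs = Suc n)"

abbreviation depth :: "'a set \<Rightarrow> 'a set set \<Rightarrow> 'a \<Rightarrow> 'a \<Rightarrow> nat" where
  "depth V E r v \<equiv> graph_dist V E r v"

definition children :: "'a set \<Rightarrow> 'a set set \<Rightarrow> 'a \<Rightarrow> 'a \<Rightarrow> 'a set" where
  "children V E r v = {u \<in> V. {v, u} \<in> E \<and> depth V E r u = Suc (depth V E r v)}"

definition leaves :: "'a set \<Rightarrow> 'a set set \<Rightarrow> 'a set" where
  "leaves V E = {v \<in> V. degree E v = 1}"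

(* Leaves are the vertices of degree one.  For t > 1 these are the nodes without
   children, except in the one-vertex graph, which this definition therefore excludes. *)
definition complete_full_tree :: "nat \<Rightarrow> 'a set \<Rightarrow> 'a set set \<Rightarrow> 'a \<Rightarrow> bool" where
  "complete_full_tree t V E r \<longleftrightarrow>
     tree V E \<and> r \<in> V \<and>
     (\<forall>v \<in> V - leaves V E. card (children V E r v) = t) \<and>
     (\<exists>d. \<forall>v \<in> leaves V E. depth V E r v = d)"

definition vertex_sum :: "'a set set \<Rightarrow> ('a set \<Rightarrow> nat) \<Rightarrow> 'a \<Rightarrow> nat" where
  "vertex_sum E f v = (\<Sum>e \<in> incident_edges E v. f e)"

definition local_antimagic_labeling :: "'a set \<Rightarrow> 'a set set \<Rightarrow> ('a set \<Rightarrow> nat) \<Rightarrow> bool" where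
  "local_antimagic_labeling V E f \<longleftrightarrow>
     bij_betw f E {1..card E} \<and>
     (\<forall>u\<in>V. \<forall>v\<in>V. {u, v} \<in> E \<longrightarrow> vertex_sum E f u \<noteq> vertex_sum E f v)"

(* Intended for finite simple graphs without isolated vertices and without components K_2.
   LEAST is unspecified for a graph that has no local antimagic labeling, so
   an equation chi_la V E = k with an explicit k can only be proved together
   with the existence of a labeling that attains k. *)
definition chi_la :: "'a set \<Rightarrow> 'a set set \<Rightarrow> nat" where
  "chi_la V E =
     (LEAST k. \<exists>f. local_antimagic_labeling V E f \<and> card (vertex_sum E f ` V) = k)"

end

theory Submission
  imports Defs
begin

text \<open>Let \<open>t = 2 * h + 1\<close>, let the tree have height \<open>n\<close>, and call a node inner if it is not a leaf, an
edge inner if it is not incident to a leaf. Let there be \<open>M\<close> inner edges and \<open>m\<close> edges in total; then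
\<open>m = t * (M + 1)\<close>.

At least \<open>l + 1\<close> colors are needed: the \<open>l\<close> leaves get distinct colors, all at most \<open>m\<close>, and the edge
labeled \<open>m\<close> has an inner end, whose color exceeds \<open>m\<close> (\<open>word_sum_colours_ge\<close>).

For the converse, the children of each inner node are indexed by \<open>-h, \<dots>, h\<close>, so that the nodes become
words over these digits. The inner edges get the labels up to \<open>M\<close>, the leaf edges the larger ones.
Let \<open>2 * c\<close> be the even number among \<open>M\<close> and \<open>M + 1\<close>. If \<open>n \<ge> 2\<close>, the labels are chosen such that:

  \<^item> The labels of the inner edges from a node to its children \<open>d\<close> and \<open>-d\<close>, where \<open>d \<noteq> 0\<close>, add up
    to \<open>2 * c\<close>. A node at depth at most \<open>n - 2\<close> then has the color \<open>2 * h * c + x + y\<close>, where \<open>x\<close> and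
    \<open>y\<close> are the labels of the edges to its parent (\<open>x = 0\<close> for the root) and to its child 0. This lies
    between \<open>M + 1\<close> and \<open>m\<close>, hence is the color of a leaf (\<open>W_inner\<close>, \<open>W_inner_range\<close>).
  \<^item> The labels of the leaf edges are paired in the same way with another sum, and the labels
    of the edges from a node at depth \<open>n - 1\<close> to its parent and to its child 0 have a constant sum. So all
    nodes at depth \<open>n - 1\<close> have the same color, which exceeds \<open>m\<close> (\<open>W_outer\<close>, \<open>W_outer_gt\<close>).
  \<^item> Adjacent nodes at depth at most \<open>n - 2\<close> have different colors (\<open>W_inner_proper\<close>). To this end
    \<open>x - c\<close> and \<open>y - c\<close> have equal signs for the nodes not ending in the digit 0, and the deviations
    from \<open>c\<close> grow with the depth. The sign of the last nonzero digit of a word serves as the sign of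
    its deviation. The words of zeros have no such sign: one of them, at depth \<open>n - 1\<close>, gets the
    label \<open>c\<close>, and the others get the labels farthest from \<open>c\<close>.

The colors are thus the \<open>l\<close> leaf colors and one more.\<close>

section \<open>Words as codes of tree nodes\<close>

text \<open>A node of the tree at depth \<open>k\<close> is coded by the word of the \<open>k\<close> child indices on the way to it,
the most recent index first, so that the parent of \<open>d # w\<close> is \<open>w\<close>. For \<open>t = 2 * h + 1\<close> the
indices are the integers from \<open>-h\<close> to \<open>h\<close>. The set \<open>L\<close> prescribes the admissible lengths.\<close>
definition words :: "int \<Rightarrow> nat set \<Rightarrow> int list set" where
  "words h L = {w. set w \<subseteq> {-h..h} \<and> length w \<in> L}"

text \<open>The sign of the most recent nonzero digit, and 0 for a word of zeros only.\<close>
fun sign :: "int list \<Rightarrow> int" where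
  "sign [] = 0"
| "sign (d # w) = (if d = 0 then sign w else sgn d)"

text \<open>Negation of the most recent nonzero digit. This length-preserving involution fixes only the
words of zeros and exchanges the siblings \<open>d # w\<close> and \<open>(- d) # w\<close>.\<close>
fun mirror :: "int list \<Rightarrow> int list" where
  "mirror [] = []"
| "mirror (d # w) = (if d = 0 then 0 # mirror w else (- d) # w)"

lemma length_mirror [simp]: "length (mirror w) = length w"
  by (induction w) auto

lemma mirror_mirror [simp]: "mirror (mirror w) = w"
  by (induction w) auto

lemma sign_mirror [simp]: "sign (mirror w) = - sign w"
  by (induction w) auto

lemma sign_cases: "sign w = 1 \<or> sign w = -1 \<or> sign w = 0"
  by (induction w) (auto simp: sgn_if)

lemma sign_eq_0_iff: "sign w = 0 \<longleftrightarrow> w = replicate (length w) 0"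
  by (induction w) (auto simp: sgn_if)

lemma set_mirror: "set w \<subseteq> {-h..h} \<Longrightarrow> set (mirror w) \<subseteq> {-h..h}"
  by (induction w) auto

lemma mirror_in_words [simp]: "mirror w \<in> words h L \<longleftrightarrow> w \<in> words h L"
  using set_mirror[of w h] set_mirror[of "mirror w" h] by (auto simp: words_def)

lemma finite_words: "finite L \<Longrightarrow> finite (words h L)"
proof -
  assume "finite L"
  have "words h L = (\<Union>k\<in>L. {w. set w \<subseteq> {-h..h} \<and> length w = k})"
    by (auto simp: words_def)
  then show ?thesis using \<open>finite L\<close> by (auto intro!: finite_lists_length_eq)
qed

text \<open>The words of sign 1: one representative of each pair that \<open>mirror\<close> exchanges.\<close>
definition pos_words :: "int \<Rightarrow> nat set \<Rightarrow> int list set" where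
  "pos_words h L = {w \<in> words h L. sign w = 1}"

lemma finite_pos_words: "finite L \<Longrightarrow> finite (pos_words h L)"
  by (simp add: pos_words_def finite_words)

text \<open>For each length, \<open>mirror\<close> pairs off all words but the word of zeros.\<close>
lemma card_words_eq_pos:
  assumes "0 \<le> h" "finite L"
  shows "card (words h L) = 2 * card (pos_words h L) + card L"
proof -
  let ?Z = "(\<lambda>k. replicate k (0::int)) ` L"
  have eq: "words h L = pos_words h L \<union> mirror ` pos_words h L \<union> ?Z"
  proof (intro equalityI subsetI)
    fix w assume w: "w \<in> words h L"
    consider "sign w = 1" | "sign w = -1" | "sign w = 0" using sign_cases by blast
    then show "w \<in> pos_words h L \<union> mirror ` pos_words h L \<union> ?Z"
    proof cases
      case 1 then show ?thesis using w by (simp add: pos_words_def)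
    next
      case 2
      then have "mirror w \<in> pos_words h L" using w by (simp add: pos_words_def)
      then have "mirror (mirror w) \<in> mirror ` pos_words h L" by blast
      then show ?thesis by simp
    next
      case 3 then show ?thesis using w sign_eq_0_iff[of w] by (auto simp: words_def)
    qed
  qed (use assms in \<open>auto simp: pos_words_def words_def set_mirror dest: set_mirror[THEN subsetD]\<close>)
  have s: "sign (replicate k 0) = 0" for k by (induction k) auto
  have fin: "finite (pos_words h L)" using assms finite_pos_words by blast
  have "card (pos_words h L \<union> mirror ` pos_words h L) = card (pos_words h L) + card (mirror ` pos_words h L)"
    by (rule card_Un_disjoint) (use fin in \<open>auto simp: pos_words_def\<close>)
  moreover have "card (mirror ` pos_words h L) = card (pos_words h L)"
    by (rule card_image) (metis inj_onI mirror_mirror)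
  moreover have "card (pos_words h L \<union> mirror ` pos_words h L \<union> ?Z)
      = card (pos_words h L \<union> mirror ` pos_words h L) + card ?Z"
    by (rule card_Un_disjoint)
       (use fin assms s in \<open>auto simp: pos_words_def dest: arg_cong[where f = sign]\<close>)
  moreover have "card ?Z = card L"
    by (rule card_image) (metis inj_onI length_replicate)
  ultimately show ?thesis using eq by simp
qed

lemma card_words_split:
  "n \<ge> 1 \<Longrightarrow> card (words h {1..n}) = card (words h {1..n - 1}) + card (words h {n})"
proof -
  assume "n \<ge> 1"
  then have "words h {1..n} = words h {1..n - 1} \<union> words h {n}"
    by (auto simp: words_def)
  moreover have "card (words h {1..n - 1} \<union> words h {n}) = card (words h {1..n - 1}) + card (words h {n})"
    by (rule card_Un_disjoint) (use \<open>n \<ge> 1\<close> in \<open>auto simp: finite_words\<close>, auto simp: words_def)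
  ultimately show ?thesis by simp
qed

text \<open>The tree of height \<open>n\<close> has \<open>t\<close> times as many edges as the tree of height \<open>n - 1\<close> has nodes.\<close>
lemma card_words_rec:
  assumes "n \<ge> 1" "0 \<le> h"
  shows "int (card (words h {1..n})) = (2 * h + 1) * (int (card (words h {1..n - 1})) + 1)"
proof -
  have "words h {1..n} = (\<lambda>(d, w). d # w) ` ({-h..h} \<times> words h {0..n - 1})"
  proof (intro equalityI subsetI)
    fix w assume w: "w \<in> words h {1..n}"
    then obtain d v where "w = d # v" by (cases w) (auto simp: words_def)
    then show "w \<in> (\<lambda>(d, w). d # w) ` ({-h..h} \<times> words h {0..n - 1})"
      using w by (auto simp: words_def)
  qed (use assms in \<open>auto simp: words_def\<close>)
  moreover have "inj_on (\<lambda>(d, w). d # w) ({-h..h} \<times> words h {0..n - 1})"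
    by (auto simp: inj_on_def)
  ultimately have "card (words h {1..n}) = card {-h..h} * card (words h {0..n - 1})"
    by (simp add: card_image card_cartesian_product)
  moreover have "words h {0..n - 1} = insert [] (words h {1..n - 1})"
    by (auto simp: words_def Suc_le_eq)
  moreover have "[] \<notin> words h {1..n - 1}" by (auto simp: words_def)
  ultimately have "card (words h {1..n}) = nat (2 * h + 1) * Suc (card (words h {1..n - 1}))"
    by (simp add: finite_words)
  then show ?thesis using assms by (simp add: algebra_simps)
qed

lemma monotone_enumeration:
  fixes key :: "'b \<Rightarrow> nat"
  assumes "finite A"
  shows "\<exists>e. bij_betw e A {1..int (card A)} \<and> (\<forall>x\<in>A. \<forall>y\<in>A. key x < key y \<longrightarrow> e x < e y)"
  using assms
proof (induction A rule: finite_ranking_induct[where f = key])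
  case empty
  show ?case by (simp add: bij_betw_def)
next
  case (insert x A)
  show ?case
  proof (cases "x \<in> A")
    case True
    then show ?thesis using insert by (simp add: insert_absorb)
  next
    case False
    from insert obtain e where e: "bij_betw e A {1..int (card A)}"
      and mono: "\<forall>x\<in>A. \<forall>y\<in>A. key x < key y \<longrightarrow> e x < e y" by blast
    let ?e = "e(x := int (card A) + 1)"
    have "bij_betw ?e A {1..int (card A)}"
      using e False by (subst bij_betw_cong[where g = e]) auto
    then have "bij_betw ?e (insert x A) (insert (?e x) {1..int (card A)})"
      by (subst insert_is_Un, subst (2) insert_is_Un, intro bij_betw_combine)
         (auto simp: bij_betw_def)
    moreover have "insert (?e x) {1..int (card A)} = {1..int (card (insert x A))}"
      using False \<open>finite A\<close> by auto
    moreover have "?e y < ?e z" if "y \<in> insert x A" "z \<in> insert x A" "key y < key z" for y z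
    proof -
      have "y \<noteq> x" using that insert(2)[of z] by auto
      then show ?thesis using that mono e by (fastforce simp: bij_betw_def)
    qed
    ultimately show ?thesis by (intro exI[of _ ?e] conjI ballI impI) (simp only:, blast)
  qed
qed

text \<open>The extension of \<open>e\<close> from the words of sign 1 to all words that changes its sign under
\<open>mirror\<close>.\<close>
definition odd_ext :: "(int list \<Rightarrow> int) \<Rightarrow> int list \<Rightarrow> int" where
  "odd_ext e w = (if sign w = 1 then e w else if sign w = -1 then - e (mirror w) else 0)"

lemma inj_on_odd_ext:
  assumes "inj_on (\<lambda>w. \<bar>e w\<bar>) (pos_words h L)" and "\<forall>w\<in>pos_words h L. e w \<noteq> 0"
  shows "inj_on (odd_ext e) {w \<in> words h L. sign w \<noteq> 0}"
proof (rule inj_onI)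
  fix v w assume v: "v \<in> {w \<in> words h L. sign w \<noteq> 0}" and w: "w \<in> {w \<in> words h L. sign w \<noteq> 0}"
    and eq: "odd_ext e v = odd_ext e w"
  define rep where "rep u = (if sign u = 1 then u else mirror u)" for u
  have rep: "rep u \<in> pos_words h L" if "u \<in> {w \<in> words h L. sign w \<noteq> 0}" for u
    using that sign_cases[of u] by (auto simp: rep_def pos_words_def)
  have val: "odd_ext e u = sign u * e (rep u)" for u
    using sign_cases[of u] by (auto simp: rep_def odd_ext_def)
  have "\<bar>e (rep v)\<bar> = \<bar>e (rep w)\<bar>"
    using eq val[of v] val[of w] v w sign_cases[of v] sign_cases[of w] by auto
  then have r: "rep v = rep w" using assms(1) rep v w by (auto dest: inj_onD)
  moreover have "e (rep v) \<noteq> 0" using assms rep v by blast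
  ultimately have "sign v = sign w" using eq val[of v] val[of w] by simp
  then show "v = w" using r by (auto simp: rep_def split: if_splits) (metis mirror_mirror)
qed

text \<open>The weight of the node \<open>w\<close> in the tree of height \<open>n\<close>, where \<open>lab w\<close> is the label of the edge
from \<open>w\<close> to its parent; the root \<open>[]\<close> has no such edge.\<close>
definition word_sum :: "int \<Rightarrow> nat \<Rightarrow> (int list \<Rightarrow> 'b::comm_monoid_add) \<Rightarrow> int list \<Rightarrow> 'b" where
  "word_sum h n lab w = (if w = [] then 0 else lab w) +
     (if length w < n then \<Sum>d\<in>{-h..h}. lab (d # w) else 0)"

lemma sum_symmetric_interval:
  fixes F :: "int \<Rightarrow> int"
  assumes "0 \<le> h" "\<And>d. d \<in> {1..h} \<Longrightarrow> F d + F (- d) = s"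
  shows "(\<Sum>d\<in>{-h..h}. F d) = F 0 + h * s"
proof -
  have "{-h..h} = {-h.. -1} \<union> insert 0 {1..h}" using assms by auto
  then have "(\<Sum>d\<in>{-h..h}. F d) = sum F {-h.. -1} + sum F (insert 0 {1..h})"
    by (simp add: sum.union_disjoint)
  also have "sum F {-h.. -1} = (\<Sum>d\<in>{1..h}. F (- d))"
    by (rule sum.reindex_bij_witness[where i = uminus and j = uminus]) auto
  finally have "(\<Sum>d\<in>{-h..h}. F d) = F 0 + (\<Sum>d\<in>{1..h}. F d + F (- d))"
    by (simp add: sum.distrib)
  then show ?thesis using assms by simp
qed

section \<open>A labeling of the words\<close>

text \<open>The data of the labeling for height \<open>n \<ge> 2\<close>. The function \<open>e\<close> enumerates the inner words of
sign 1 by increasing length. The function \<open>g\<close> enumerates the leaves of sign 1 that are not a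
zero child; it avoids the values of \<open>e\<close> on the words of length \<open>n - 1\<close>, because the
labels of the zero children of these words have them as distances from the midpoint.\<close>
locale word_labelling =
  fixes h :: int and n :: nat and e g :: "int list \<Rightarrow> int" and P R :: int
  assumes h: "1 \<le> h" and n: "2 \<le> n"
    and P_def: "P = int (card (pos_words h {1..n - 1}))"
    and R_def: "R = int (card (pos_words h {n}))"
    and e_bij: "bij_betw e (pos_words h {1..n - 1}) {1..P}"
    and e_mono: "\<And>v w. v \<in> pos_words h {1..n - 1} \<Longrightarrow> w \<in> pos_words h {1..n - 1} \<Longrightarrow>
                   length v < length w \<Longrightarrow> e v < e w"
    and g_bij: "bij_betw g {w \<in> pos_words h {n}. hd w \<noteq> 0} ({1..R} - e ` pos_words h {n - 1})"
begin

text \<open>\<open>M\<close> is the number of edges that are not incident to a leaf, \<open>m\<close> the number of all edges. The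
labels of mirrored inner words lie symmetrically about \<open>c\<close>, those of mirrored leaves
about \<open>c'\<close>, the midpoint of \<open>{M + 1..m}\<close>.\<close>
definition "M = 2 * P + int n - 1"
definition "m = M + 2 * R + 1"
definition "c = P + int (n div 2)"
definition "c' = M + 1 + R"
text \<open>The zero child of \<open>v\<close> gets the deviation opposite to that of \<open>v\<close>, so that the two labels
have the constant sum \<open>c + c'\<close>.\<close>
definition "G w = (if hd w = 0 then - e (tl w) else g w)"

text \<open>The label of the edge above \<open>w\<close>. The words of zeros of length less than \<open>n - 1\<close> get the labels
that are farthest from \<open>c\<close>: with increasing length, first \<open>M, M - 1, \<dots>\<close> downwards, and then, from
the label complementary to the last of these with respect to \<open>2 * c\<close>, downwards to 1.\<close>
definition lab :: "int list \<Rightarrow> int" where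
  "lab w = (if length w = n then c' + odd_ext G w
            else if sign w \<noteq> 0 then c + odd_ext e w
            else if length w = n - 1 then c
            else if length w + n div 2 \<le> n - 1 then M + 1 - int (length w)
            else int (n - 1 - length w))"

abbreviation "W \<equiv> word_sum h n lab"

lemma card_inner: "int (card (words h {1..n - 1})) = M"
proof -
  have "int (card (words h {1..n - 1})) = 2 * P + int (n - 1)"
    using card_words_eq_pos[of h "{1..n - 1}"] h P_def by simp
  then show ?thesis using n by (simp add: M_def)
qed

lemma card_all: "int (card (words h {1..n})) = m"
  using card_words_split[of n h] card_words_eq_pos[of h "{n}"] card_inner h n
  by (simp add: m_def flip: R_def)

lemma m_eq: "m = (2 * h + 1) * (M + 1)"
  using card_words_rec[of n h] card_all card_inner h n by simp

lemma two_c: "2 * c = M \<or> 2 * c = M + 1"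
  by (auto simp: c_def M_def)

lemma P_nonneg: "0 \<le> P" and R_nonneg: "0 \<le> R"
  by (simp_all add: P_def R_def)

text \<open>So the values of \<open>e\<close> lie in the range \<open>{1..R}\<close> that serves for the leaves.\<close>
lemma P_le_R: "P \<le> R"
proof -
  have "int (card (words h {1..n})) \<ge> 3 * (M + 1)"
    using m_eq card_all h mult_right_mono[of 3 "2 * h + 1" "M + 1"] P_nonneg n
    by (simp add: M_def)
  then show ?thesis using card_all n P_nonneg by (simp add: m_def M_def)
qed

lemma e_range: "w \<in> pos_words h {1..n - 1} \<Longrightarrow> 1 \<le> e w \<and> e w \<le> P"
  using e_bij by (auto simp: bij_betw_def)

lemma odd_ext_e_range:
  assumes "w \<in> words h {1..n - 1}" "sign w \<noteq> 0"
  shows "1 \<le> sign w * odd_ext e w" "sign w * odd_ext e w \<le> P"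
proof -
  have "w \<in> pos_words h {1..n - 1} \<or> mirror w \<in> pos_words h {1..n - 1}"
    using assms sign_cases[of w] by (auto simp: pos_words_def)
  moreover have "sign w = 1 \<longleftrightarrow> w \<in> pos_words h {1..n - 1}"
    using assms by (auto simp: pos_words_def)
  ultimately show "1 \<le> sign w * odd_ext e w" "sign w * odd_ext e w \<le> P"
    using e_range sign_cases[of w] assms by (auto simp: odd_ext_def)
qed

text \<open>For inner words of nonzero sign, the distance of the label from \<open>c\<close> grows strictly with the
length.\<close>
lemma odd_ext_e_mono:
  assumes "v \<in> words h {1..n - 1}" "sign v \<noteq> 0" "w \<in> words h {1..n - 1}" "sign w \<noteq> 0"
    and "length v < length w"
  shows "sign v * odd_ext e v < sign w * odd_ext e w"
proof -
  define rep where "rep u = (if sign u = 1 then u else mirror u)" for u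
  have "rep u \<in> pos_words h {1..n - 1}" "sign u * odd_ext e u = e (rep u)" "length (rep u) = length u"
    if "u \<in> words h {1..n - 1}" "sign u \<noteq> 0" for u
    using that sign_cases[of u] by (auto simp: rep_def pos_words_def odd_ext_def)
  then show ?thesis using assms e_mono[of "rep v" "rep w"] by simp
qed

lemma lab_nonzero:
  assumes "w \<in> words h {1..n - 1}" "sign w \<noteq> 0"
  shows "lab w = c + odd_ext e w"
  using assms n by (auto simp: lab_def words_def)

lemma lab_spine:
  assumes "w \<in> words h {1..n - 1}" "sign w = 0"
  shows "lab w = (if length w = n - 1 then c
            else if length w + n div 2 \<le> n - 1 then M + 1 - int (length w)
            else int n - 1 - int (length w))"
  using assms n by (auto simp: lab_def words_def)

lemma lab_inner_range:
  assumes "w \<in> words h {1..n - 1}"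
  shows "1 \<le> lab w \<and> lab w \<le> M"
proof (cases "sign w = 0")
  case True
  have "1 \<le> length w" "length w \<le> n - 1" using assms by (auto simp: words_def)
  then show ?thesis unfolding lab_spine[OF assms True] using n P_nonneg
    by (auto simp: c_def M_def)
next
  case False
  show ?thesis unfolding lab_nonzero[OF assms False]
    using odd_ext_e_range[OF assms False] sign_cases[of w] False n by (auto simp: c_def M_def)
qed

lemma lab_inner_inj: "inj_on lab (words h {1..n - 1})"
proof (rule inj_onI)
  fix v w assume v: "v \<in> words h {1..n - 1}" and w: "w \<in> words h {1..n - 1}" and eq: "lab v = lab w"
  have lv: "1 \<le> length v" "length v \<le> n - 1" "1 \<le> length w" "length w \<le> n - 1"
    using v w by (auto simp: words_def)
  have mixed: False if "x \<in> words h {1..n - 1}" "y \<in> words h {1..n - 1}" "lab x = lab y"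
      "sign x = 0" "sign y \<noteq> 0" for x y
  proof -
    have l: "1 \<le> length x" "length x \<le> n - 1" using that by (auto simp: words_def)
    show False using lab_spine[OF that(1,4)] lab_nonzero[OF that(2,5)] odd_ext_e_range[OF that(2,5)]
       that(3) sign_cases[of y] that(5) n l P_nonneg
      by (auto simp: c_def M_def split: if_splits)
  qed
  consider "sign v = 0" "sign w = 0" | "sign v \<noteq> 0" "sign w \<noteq> 0"
    using mixed[OF v w eq] mixed[OF w v eq[symmetric]] by blast
  then show "v = w"
  proof cases
    case 1
    have "length v = length w"
      using eq lv n P_nonneg unfolding lab_spine[OF v 1(1)] lab_spine[OF w 1(2)]
      by (auto simp: c_def M_def split: if_splits)
    then show ?thesis using 1 sign_eq_0_iff by metis
  next
    case 2
    have "inj_on (odd_ext e) {w \<in> words h {1..n - 1}. sign w \<noteq> 0}"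
    proof (rule inj_on_odd_ext)
      have "inj_on e (pos_words h {1..n - 1})" using e_bij by (simp add: bij_betw_def)
      then show "inj_on (\<lambda>w. \<bar>e w\<bar>) (pos_words h {1..n - 1})"
        using e_range by (smt (verit) inj_on_def)
    qed (use e_range in force)
    moreover have "odd_ext e v = odd_ext e w" using eq lab_nonzero v w 2 by simp
    ultimately show ?thesis using v w 2 by (auto dest: inj_onD)
  qed
qed

text \<open>The absolute value of \<open>G\<close> tells zero children from the other leaves.\<close>
lemma G_abs:
  assumes "w \<in> pos_words h {n}"
  shows "1 \<le> \<bar>G w\<bar> \<and> \<bar>G w\<bar> \<le> R" and "hd w = 0 \<longleftrightarrow> \<bar>G w\<bar> \<in> e ` pos_words h {n - 1}"
proof -
  have sub: "pos_words h {n - 1} \<subseteq> pos_words h {1..n - 1}"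
    using n by (auto simp: pos_words_def words_def)
  obtain d v where w: "w = d # v" using assms n by (cases w) (auto simp: pos_words_def words_def)
  have "(1 \<le> \<bar>G w\<bar> \<and> \<bar>G w\<bar> \<le> R) \<and> (hd w = 0 \<longleftrightarrow> \<bar>G w\<bar> \<in> e ` pos_words h {n - 1})"
  proof (cases "d = 0")
    case True
    then have "v \<in> pos_words h {n - 1}" using assms w n by (auto simp: pos_words_def words_def)
    moreover have "1 \<le> e v" "e v \<le> P" using e_range calculation sub by blast+
    ultimately show ?thesis using P_le_R True w by (auto simp: G_def)
  next
    case False
    then have "w \<in> {w \<in> pos_words h {n}. hd w \<noteq> 0}" using assms w by simp
    then have "g w \<in> {1..R} - e ` pos_words h {n - 1}"
      using bij_betw_apply[OF g_bij] by blast
    then show ?thesis using False w by (auto simp: G_def)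
  qed
  then show "1 \<le> \<bar>G w\<bar> \<and> \<bar>G w\<bar> \<le> R" and "hd w = 0 \<longleftrightarrow> \<bar>G w\<bar> \<in> e ` pos_words h {n - 1}"
    by blast+
qed

lemma inj_abs_G: "inj_on (\<lambda>w. \<bar>G w\<bar>) (pos_words h {n})"
proof (rule inj_onI)
  fix v w assume v: "v \<in> pos_words h {n}" and w: "w \<in> pos_words h {n}" and eq: "\<bar>G v\<bar> = \<bar>G w\<bar>"
  have iff: "hd v = 0 \<longleftrightarrow> hd w = 0" using G_abs(2)[OF v] G_abs(2)[OF w] eq by simp
  have ne: "v \<noteq> []" "w \<noteq> []" using v w n by (auto simp: pos_words_def words_def)
  show "v = w"
  proof (cases "hd v = 0")
    case True
    have "tl u \<in> pos_words h {1..n - 1}" if "u \<in> {v, w}" for u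
      using that v w True iff n by (cases u) (auto simp: pos_words_def words_def)
    then have "tl v \<in> pos_words h {1..n - 1}" "tl w \<in> pos_words h {1..n - 1}" by auto
    moreover from this have "e (tl v) = e (tl w)"
      using eq True iff e_range[of "tl v"] e_range[of "tl w"] by (simp add: G_def)
    ultimately have "tl v = tl w" using e_bij by (auto simp: bij_betw_def dest: inj_onD)
    then show ?thesis using True iff ne by (metis list.collapse)
  next
    case False
    have pos: "u \<in> pos_words h {n} \<Longrightarrow> hd u \<noteq> 0 \<Longrightarrow> g u \<ge> 1" for u
      using bij_betw_apply[OF g_bij, of u] by simp
    have "g v = g w" using eq False iff pos[OF v] pos[OF w] by (simp add: G_def)
    then show ?thesis using False iff v w g_bij by (auto simp: bij_betw_def dest: inj_onD)
  qed
qed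

lemma lab_outer: "w \<in> words h {n} \<Longrightarrow> lab w = c' + odd_ext G w"
  by (auto simp: lab_def words_def)

lemma lab_outer_range:
  assumes "w \<in> words h {n}"
  shows "M + 1 \<le> lab w \<and> lab w \<le> m"
proof -
  have "sign w = 1 \<Longrightarrow> w \<in> pos_words h {n}" "sign w = -1 \<Longrightarrow> mirror w \<in> pos_words h {n}"
    using assms by (auto simp: pos_words_def)
  then have "\<bar>odd_ext G w\<bar> \<le> R"
    using G_abs(1)[of w] G_abs(1)[of "mirror w"] R_nonneg by (auto simp: odd_ext_def)
  then show ?thesis using lab_outer[OF assms] by (auto simp: c'_def m_def)
qed

lemma lab_outer_inj: "inj_on lab (words h {n})"
proof (rule inj_onI)
  fix v w assume v: "v \<in> words h {n}" and w: "w \<in> words h {n}" and "lab v = lab w"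
  then have eq: "odd_ext G v = odd_ext G w" by (simp add: lab_outer)
  have nz: "odd_ext G u = 0 \<longleftrightarrow> sign u = 0" if "u \<in> words h {n}" for u
    using that G_abs(1)[of u] G_abs(1)[of "mirror u"] sign_cases[of u]
    by (auto simp: odd_ext_def pos_words_def)
  show "v = w"
  proof (cases "sign v = 0")
    case True
    then have "sign w = 0" using nz[OF v] nz[OF w] eq by simp
    then show ?thesis using True sign_eq_0_iff[of v] sign_eq_0_iff[of w] v w
      by (auto simp: words_def)
  next
    case False
    have "inj_on (odd_ext G) {w \<in> words h {n}. sign w \<noteq> 0}"
      by (rule inj_on_odd_ext[OF inj_abs_G]) (use G_abs(1) in force)
    moreover have "sign w \<noteq> 0" using False nz[OF v] nz[OF w] eq by simp
    ultimately show ?thesis using False v w eq by (auto dest: inj_onD)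
  qed
qed

lemma words_split: "words h {1..n} = words h {1..n - 1} \<union> words h {n}"
  using n by (auto simp: words_def)

lemma lab_bij: "bij_betw lab (words h {1..n}) {1..m}"
proof -
  have "inj_on lab (words h {1..n})"
    unfolding words_split
  proof (subst inj_on_Un, intro conjI)
    show "lab ` (words h {1..n - 1} - words h {n}) \<inter> lab ` (words h {n} - words h {1..n - 1}) = {}"
      using lab_inner_range lab_outer_range by force
  qed (fact lab_inner_inj lab_outer_inj)+
  moreover have "lab ` words h {1..n} \<subseteq> {1..m}"
    using lab_inner_range lab_outer_range R_nonneg P_nonneg n
    unfolding words_split by (force simp: m_def M_def)
  moreover have "card {1..m} = card (words h {1..n})" using card_all by simp
  ultimately show ?thesis
    by (metis bij_betw_def card_image card_subset_eq finite_atLeastAtMost_int)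
qed

lemma lab_outer_image: "lab ` words h {n} = {M + 1..m}"
proof (rule card_subset_eq)
  have "int (card (words h {n})) = 2 * R + 1"
    using card_words_eq_pos[of h "{n}"] h R_def by simp
  then show "card (lab ` words h {n}) = card {M + 1..m}"
    by (simp add: card_image[OF lab_outer_inj] m_def)
qed (use lab_outer_range in auto)

text \<open>Siblings \<open>d # w\<close> and \<open>(- d) # w\<close> contribute \<open>2 * c\<close>, so only the two labels on the edges to the
parent and to the zero child distinguish the weights.\<close>
lemma W_inner:
  assumes "w \<in> words h {0..n - 2}"
  shows "W w = (if w = [] then 0 else lab w) + lab (0 # w) + h * (2 * c)"
proof -
  have l: "length w + 2 \<le> n" using assms n by (auto simp: words_def)
  have "(\<Sum>d\<in>{-h..h}. lab (d # w)) = lab (0 # w) + h * (2 * c)"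
  proof (rule sum_symmetric_interval)
    fix d assume d: "d \<in> {1..h}"
    then have "d # w \<in> words h {1..n - 1}" "(- d) # w \<in> words h {1..n - 1}"
      using assms l by (auto simp: words_def)
    then show "lab (d # w) + lab ((- d) # w) = 2 * c"
      using d by (simp add: lab_nonzero odd_ext_def)
  qed (use h in simp)
  then show ?thesis using l by (simp add: word_sum_def)
qed

lemma W_outer:
  assumes "w \<in> words h {n - 1}"
  shows "W w = c + c' + h * (2 * c')"
proof -
  have l: "length w + 1 = n" using assms n by (auto simp: words_def)
  have "(\<Sum>d\<in>{-h..h}. lab (d # w)) = lab (0 # w) + h * (2 * c')"
  proof (rule sum_symmetric_interval)
    fix d assume d: "d \<in> {1..h}"
    then have "d # w \<in> words h {n}" "(- d) # w \<in> words h {n}"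
      using assms l by (auto simp: words_def)
    then show "lab (d # w) + lab ((- d) # w) = 2 * c'"
      using d by (simp add: lab_outer odd_ext_def)
  qed (use h in simp)
  moreover have "lab (0 # w) + lab w = c + c'"
  proof -
    have 1: "0 # w \<in> words h {n}" "w \<in> words h {1..n - 1}" using assms l h n by (auto simp: words_def)
    show ?thesis
    proof (cases "sign w = 0")
      case True
      moreover have "length w = n - 1" using l by simp
      ultimately show ?thesis using lab_outer[OF 1(1)] lab_spine[OF 1(2)] by (simp add: odd_ext_def)
    next
      case False
      then show ?thesis using lab_outer[OF 1(1)] lab_nonzero[OF 1(2)] sign_cases[of w]
        by (auto simp: odd_ext_def G_def)
    qed
  qed
  moreover have "w \<noteq> []" using l n by auto
  ultimately show ?thesis using l by (simp add: word_sum_def)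
qed

lemma W_leaf:
  assumes "w \<in> words h {n}"
  shows "W w = lab w"
  using assms n by (auto simp: word_sum_def words_def)

text \<open>The weights of the nodes at depth at most \<open>n - 2\<close> are labels of leaf edges.\<close>
lemma W_inner_range:
  assumes "w \<in> words h {0..n - 2}"
  shows "M < W w \<and> W w \<le> m"
proof -
  have "0 # w \<in> words h {1..n - 1}" using assms h n by (auto simp: words_def)
  then have 1: "1 \<le> lab (0 # w)" "lab (0 # w) \<le> M" using lab_inner_range by blast+
  have 2: "0 \<le> (if w = [] then 0 else lab w)" "(if w = [] then 0 else lab w) \<le> M"
  proof -
    have "w \<noteq> [] \<Longrightarrow> w \<in> words h {1..n - 1}" using assms n by (cases w) (auto simp: words_def)
    then show "0 \<le> (if w = [] then 0 else lab w)" "(if w = [] then 0 else lab w) \<le> M"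
      using lab_inner_range[of w] 1 by auto
  qed
  have M: "0 \<le> M" using 1 by simp
  have "1 * (2 * c) \<le> h * (2 * c)" using two_c h M by (intro mult_right_mono) auto
  then have "M \<le> h * (2 * c)" using two_c by linarith
  moreover have "h * (2 * c) \<le> h * (M + 1)" using two_c h by (intro mult_left_mono) auto
  moreover have "2 * M \<le> (h + 1) * (M + 1)" using h M mult_right_mono[of 2 "h + 1" "M + 1"] by simp
  moreover have "m = (h + 1) * (M + 1) + h * (M + 1)" using m_eq by (simp add: algebra_simps)
  ultimately show ?thesis unfolding W_inner[OF assms] using 1 2 by linarith
qed

lemma W_outer_gt: "m < c + c' + h * (2 * c')"
proof -
  have pos: "0 < c" "0 \<le> M" "0 \<le> m"
    using P_nonneg R_nonneg n by (auto simp: c_def M_def m_def)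
  have eq: "2 * c' = M + 1 + m" by (simp add: c'_def m_def)
  have "1 * (2 * c') \<le> h * (2 * c')"
    using h pos eq by (intro mult_right_mono) auto
  then show ?thesis using pos eq by linarith
qed

text \<open>Adjacent nodes at depth at most \<open>n - 2\<close> have different weights. For a zero child \<open>0 # u\<close> the two weights differ
because they share a label. Otherwise the deviations of the two decisive labels of \<open>d # u\<close>
have the same sign. Each exceeds in absolute value the corresponding one of \<open>u\<close>, unless \<open>u\<close>
consists of zeros, in which case the extreme labels decide.\<close>
lemma W_inner_proper:
  assumes u: "u \<in> words h {0..n - 3}" and n3: "3 \<le> n" and d: "d \<in> {-h..h}"
  shows "W u \<noteq> W (d # u)"
proof -
  have "u \<in> words h {0..n - 2}" "d # u \<in> words h {0..n - 2}"
    using u d n3 by (auto simp: words_def)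
  note Wu = W_inner[OF this(1)] and Wv = W_inner[OF this(2)]
  have words: "0 # u \<in> words h {1..n - 1}" "d # u \<in> words h {1..n - 1}"
    "0 # d # u \<in> words h {1..n - 1}" using u d n3 h by (auto simp: words_def)
  have uw: "u \<noteq> [] \<Longrightarrow> u \<in> words h {1..n - 1}" using u n3 by (cases u) (auto simp: words_def)
  show ?thesis
  proof (cases "d = 0")
    case True
    have "(if u = [] then 0 else lab u) \<noteq> lab (0 # 0 # u)"
    proof (cases "u = []")
      case False
      \<comment> \<open>After cancelling the common label of \<open>0 # u\<close>, labels of two distinct edges remain.\<close>
      have "0 # 0 # u \<noteq> u" by (metis length_Cons n_not_Suc_n lessI less_SucI less_irrefl)
      then show ?thesis using inj_onD[OF lab_inner_inj _ uw words(3)] False True by auto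
    qed (use words(3) True lab_inner_range in force)
    then show ?thesis unfolding Wu Wv using True by simp
  next
    case False
    define x where "x = odd_ext e (d # u)"
    define y where "y = odd_ext e (0 # d # u)"
    define \<sigma> where "\<sigma> = sign (d # u)"
    have s0: "sign (d # u) \<noteq> 0" "sign (0 # d # u) \<noteq> 0" using False by (auto simp: sgn_if)
    have \<sigma>: "\<sigma> = 1 \<or> \<sigma> = -1" and s: "sign (0 # d # u) = \<sigma>"
      using False by (auto simp: sgn_if \<sigma>_def)
    have xy: "1 \<le> \<sigma> * x" "1 \<le> \<sigma> * y" "\<sigma> * x \<le> P" "\<sigma> * y \<le> P"
      using odd_ext_e_range[OF words(2) s0(1)] odd_ext_e_range[OF words(3) s0(2)]
      unfolding s by (simp_all only: x_def y_def \<sigma>_def)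
    have Wv': "W (d # u) = 2 * c + x + y + h * (2 * c)"
      unfolding Wv lab_nonzero[OF words(2) s0(1)] lab_nonzero[OF words(3) s0(2)]
      by (simp add: x_def y_def)
    consider "u = []" | "u \<noteq> []" "sign u = 0" | "u \<noteq> []" "sign u \<noteq> 0" by blast
    then show ?thesis
    proof cases
      case 1
      have "lab [0] = M" using lab_spine[OF words(1)] 1 n3 by auto
      then have "W u = M + h * (2 * c)" unfolding Wu using 1 by simp
      then show ?thesis unfolding Wv' using two_c xy \<sigma> by (elim disjE) simp_all
    next
      case 2
      \<comment> \<open>The labels of \<open>u\<close> and \<open>0 # u\<close> are both above all others, or complementary, or both below.\<close>
      have l: "1 \<le> length u" "length u + 3 \<le> n" using u n3 2 by (auto simp: words_def Suc_le_eq)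
      have "lab u + lab (0 # u) - 2 * c > 2 * P \<or> lab u + lab (0 # u) = 2 * c
          \<or> lab u + lab (0 # u) - 2 * c < - (2 * P)"
        using lab_spine[OF uw[OF 2(1)] 2(2)] lab_spine[OF words(1)] 2 l
        by (auto simp: c_def M_def)
      moreover have "W u = lab u + lab (0 # u) + h * (2 * c)" unfolding Wu using 2 by simp
      ultimately show ?thesis unfolding Wv' using xy \<sigma> by (elim disjE) simp_all
    next
      case 3
      define x' where "x' = odd_ext e u"
      define y' where "y' = odd_ext e (0 # u)"
      define \<tau> where "\<tau> = sign u"
      have \<tau>: "\<tau> = 1 \<or> \<tau> = -1" and t: "sign (0 # u) = \<tau>" and t0: "sign (0 # u) \<noteq> 0"
        using 3 sign_cases[of u] by (auto simp: \<tau>_def)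
      have "\<tau> * x' < \<sigma> * x"
        using odd_ext_e_mono[OF uw[OF 3(1)] 3(2) words(2) s0(1)]
        by (simp del: sign.simps add: x_def x'_def \<sigma>_def \<tau>_def)
      moreover have "\<tau> * y' < \<sigma> * y"
        using odd_ext_e_mono[OF words(1) t0 words(3) s0(2)]
        by (simp del: sign.simps add: y_def y'_def s t)
      moreover have "1 \<le> \<tau> * x'" "1 \<le> \<tau> * y'"
        using odd_ext_e_range[OF uw[OF 3(1)] 3(2)] odd_ext_e_range[OF words(1) t0]
        by (simp_all only: x'_def y'_def \<tau>_def t)
      moreover have "W u = 2 * c + x' + y' + h * (2 * c)"
        unfolding Wu using lab_nonzero[OF uw[OF 3(1)] 3(2)] lab_nonzero[OF words(1) t0] 3
        by (simp add: x'_def y'_def)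
      ultimately show ?thesis unfolding Wv' using xy \<sigma> \<tau> by (elim disjE) simp_all
    qed
  qed
qed

lemma W_proper:
  assumes u: "u \<in> words h {0..<n}" and d: "d \<in> {-h..h}"
  shows "W u \<noteq> W (d # u)"
proof -
  consider "length u = n - 1" | "length u = n - 2" | "length u + 3 \<le> n"
    using u by (force simp: words_def)
  then show ?thesis
  proof cases
    case 1
    then have "u \<in> words h {n - 1}" "d # u \<in> words h {n}" using u d n by (auto simp: words_def)
    then show ?thesis using W_outer W_outer_gt W_leaf[of "d # u"] lab_outer_range[of "d # u"] by force
  next
    case 2
    then have "u \<in> words h {0..n - 2}" "d # u \<in> words h {n - 1}" using u d n by (auto simp: words_def)
    then show ?thesis using W_outer W_outer_gt W_inner_range[of u] by force
  next
    case 3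
    then show ?thesis using u d by (intro W_inner_proper) (auto simp: words_def)
  qed
qed

lemma W_colours:
  assumes "w \<in> words h {0..<n}"
  shows "W w \<in> insert (c + c' + h * (2 * c')) (lab ` words h {n})"
proof (cases "length w = n - 1")
  case True
  then have "w \<in> words h {n - 1}" using assms by (auto simp: words_def)
  then show ?thesis using W_outer by simp
next
  case False
  then have "w \<in> words h {0..n - 2}" using assms by (auto simp: words_def)
  then show ?thesis using W_inner_range[of w] lab_outer_image by auto
qed

end

text \<open>For \<open>n = 1\<close> the tree is a star, and every bijective labeling will do.\<close>
lemma word_labelling_exists_int:
  assumes h: "1 \<le> h" and n: "1 \<le> n"
  shows "\<exists>lab :: int list \<Rightarrow> int. bij_betw lab (words h {1..n}) {1..int (card (words h {1..n}))} \<and>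
    (\<exists>C. \<forall>w\<in>words h {0..<n}. word_sum h n lab w \<in> insert C (lab ` words h {n})) \<and>
    (\<forall>w\<in>words h {0..<n}. \<forall>d\<in>{-h..h}. word_sum h n lab w \<noteq> word_sum h n lab (d # w))"
proof (cases "n = 1")
  case True
  obtain lab :: "int list \<Rightarrow> int" where lab: "bij_betw lab (words h {1..n}) {1..int (card (words h {1..n}))}"
    using monotone_enumeration[OF finite_words[of "{1..n}" h], of length] by auto
  have w: "words h {0..<n} = {[]}" using True by (auto simp: words_def)
  have "word_sum h n lab [] \<noteq> word_sum h n lab [d]" if d: "d \<in> {-h..h}" for d
  proof -
    have pos: "1 \<le> lab [d]" if "d \<in> {-h..h}" for d
    proof -
      have "[d] \<in> words h {1..n}" using that True by (auto simp: words_def)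
      then show ?thesis using lab by (auto simp: bij_betw_def)
    qed
    obtain d' where d': "d' \<in> {-h..h} - {d}"
      using h by (metis Diff_iff atLeastAtMost_iff empty_iff insert_iff less_le not_le
          dual_order.trans le_minus_one_simps(2) neg_le_0_iff_le zero_neq_one)
    have "(\<Sum>d\<in>{-h..h}. lab [d]) = lab [d] + (\<Sum>d\<in>{-h..h} - {d}. lab [d])"
      using d by (simp add: sum.remove)
    moreover have "0 < (\<Sum>d\<in>{-h..h} - {d}. lab [d])"
      by (rule sum_pos2[of _ d']) (use d' pos in force)+
    ultimately show ?thesis using True by (simp add: word_sum_def)
  qed
  then show ?thesis using lab w by (intro exI[of _ lab]) auto
next
  case False
  then have n2: "2 \<le> n" using n by simp
  let ?P = "int (card (pos_words h {1..n - 1}))" and ?R = "int (card (pos_words h {n}))"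
  obtain e where e: "bij_betw e (pos_words h {1..n - 1}) {1..?P}"
    and mono: "\<forall>v\<in>pos_words h {1..n - 1}. \<forall>w\<in>pos_words h {1..n - 1}. length v < length w \<longrightarrow> e v < e w"
    using monotone_enumeration[OF finite_pos_words[of "{1..n - 1}" h], of length] by auto
  let ?A = "{w \<in> pos_words h {n}. hd w \<noteq> 0}" and ?B = "{1..?R} - e ` pos_words h {n - 1}"
  have sub: "pos_words h {n - 1} \<subseteq> pos_words h {1..n - 1}"
    using n2 by (auto simp: pos_words_def words_def)
  have "pos_words h {n} = ?A \<union> (#) 0 ` pos_words h {n - 1}"
  proof (intro equalityI subsetI)
    fix w assume w: "w \<in> pos_words h {n}"
    then obtain d v where "w = d # v" using n by (cases w) (auto simp: pos_words_def words_def)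
    then show "w \<in> ?A \<union> (#) 0 ` pos_words h {n - 1}"
      using w by (auto simp: pos_words_def words_def)
  qed (use n h in \<open>auto simp: pos_words_def words_def subset_iff\<close>)
  moreover have "card (?A \<union> (#) 0 ` pos_words h {n - 1}) = card ?A + card ((#) 0 ` pos_words h {n - 1})"
    by (rule card_Un_disjoint) (auto simp: finite_pos_words)
  ultimately have "card (pos_words h {n}) = card ?A + card ((#) 0 ` pos_words h {n - 1})" by simp
  then have cA: "card (pos_words h {n}) = card ?A + card (pos_words h {n - 1})"
    by (simp add: card_image)
  have "?P \<le> ?R"
  proof -
    have "int (card (words h {1..n})) \<ge> 3 * (int (card (words h {1..n - 1})) + 1)"
      using card_words_rec[of n h] h n mult_right_mono[of 3 "2 * h + 1" "int (card (words h {1..n - 1})) + 1"]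
      by simp
    then show ?thesis
      using card_words_split[of n h] card_words_eq_pos[of h "{n}"] card_words_eq_pos[of h "{1..n - 1}"] n2 h
      by simp
  qed
  then have "e ` pos_words h {n - 1} \<subseteq> {1..?R}" using e sub by (force simp: bij_betw_def)
  moreover have "card (e ` pos_words h {n - 1}) = card (pos_words h {n - 1})"
    using e sub by (meson bij_betw_def card_image inj_on_subset)
  ultimately have "card ?B = card ?A"
    using cA by (simp add: card_Diff_subset finite_subset[OF _ finite_atLeastAtMost_int])
  then obtain g where g: "bij_betw g ?A ?B"
    using finite_same_card_bij[of ?A ?B] finite_pos_words[of "{n}" h] by auto
  interpret word_labelling h n e g ?P ?R
    by unfold_locales (use h n2 e mono g in auto)
  show ?thesis using lab_bij W_colours W_proper unfolding card_all[symmetric] by blast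
qed

section \<open>Rooted trees and their codes\<close>

lemma walk_Cons_iff:
  "walk V E (x # xs) \<longleftrightarrow> x \<in> V \<and> (xs = [] \<or> {x, hd xs} \<in> E \<and> walk V E xs)"
  by (cases xs) (auto simp: walk_def)

lemma walk_append_tl:
  assumes "walk V E xs" "walk V E ys" "last xs = hd ys"
  shows "walk V E (xs @ tl ys)"
  using assms
proof (induction xs)
  case (Cons x xs)
  then show ?case by (cases ys) (auto simp: walk_Cons_iff split: if_splits)
qed (simp add: walk_def)

lemma walk_rev: "walk V E xs \<Longrightarrow> walk V E (rev xs)"
  by (auto simp: walk_def successively_rev insert_commute)

lemma walk_imp_path:
  assumes "walk V E xs"
  shows "\<exists>ys. walk V E ys \<and> hd ys = hd xs \<and> last ys = last xs \<and> distinct ys \<and> set ys \<subseteq> set xs"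
  using assms
proof (induction xs)
  case (Cons x xs)
  show ?case
  proof (cases "xs = []")
    case True
    then show ?thesis using Cons by (intro exI[of _ "[x]"]) auto
  next
    case False
    then obtain ys where ys: "walk V E ys" "hd ys = hd xs" "last ys = last xs" "distinct ys" "set ys \<subseteq> set xs"
      using Cons by (auto simp: walk_Cons_iff)
    have ne: "ys \<noteq> []" using ys by (auto simp: walk_def)
    show ?thesis
    proof (cases "x \<in> set ys")
      case True
      then obtain as bs where "ys = as @ x # bs" by (meson split_list)
      then have "walk V E (x # bs)" using ys(1) by (auto simp: walk_def successively_append_iff)
      then show ?thesis using \<open>ys = as @ x # bs\<close> ys False by (intro exI[of _ "x # bs"]) auto
    next
      case nx: False
      then show ?thesis using ys ne False Cons.prems
        by (intro exI[of _ "x # ys"]) (auto simp: walk_Cons_iff)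
    qed
  qed
qed (simp add: walk_def)

text \<open>A tree with a chosen root.\<close>
locale rooted_tree =
  fixes V :: "'a set" and E :: "'a set set" and r :: 'a
  assumes tree: "tree V E" and root: "r \<in> V"
begin

abbreviation "dep \<equiv> depth V E r"

lemma finite_V: "finite V"
  using tree by (simp add: tree_def simple_graph_def)

lemma edge_verts: "{u, v} \<in> E \<Longrightarrow> u \<in> V \<and> v \<in> V \<and> u \<noteq> v"
  using tree by (fastforce simp: tree_def simple_graph_def)

lemma edge_obtain:
  assumes "e \<in> E"
  obtains u v where "e = {u, v}"
  using assms tree by (auto simp: tree_def simple_graph_def card_2_iff)

lemma dep_le: "walk V E xs \<Longrightarrow> hd xs = r \<Longrightarrow> dep (last xs) \<le> length xs - 1"
  unfolding graph_dist_def
  by (rule Least_le) (auto simp: walk_def intro!: exI[of _ xs])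

lemma shortest_walk:
  assumes "v \<in> V"
  obtains xs where "walk V E xs" "hd xs = r" "last xs = v" "length xs = Suc (dep v)"
proof -
  obtain xs where "walk V E xs" "hd xs = r" "last xs = v"
    using tree root assms unfolding tree_def connected_graph_def by blast
  then have "\<exists>n. \<exists>xs. walk V E xs \<and> hd xs = r \<and> last xs = v \<and> length xs = Suc n"
    by (intro exI[of _ "length xs - 1"] exI[of _ xs]) (auto simp: walk_def)
  from LeastI_ex[OF this] show ?thesis
    unfolding graph_dist_def[symmetric] using that by blast
qed

lemma dep_root: "dep r = 0"
  using dep_le[of "[r]"] root by (simp add: walk_def)

lemma dep_eq_0: "v \<in> V \<Longrightarrow> dep v = 0 \<Longrightarrow> v = r"
  by (metis shortest_walk One_nat_def length_Suc_conv length_0_conv list.sel(1) last_ConsL)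

lemma dep_edge_le:
  assumes "{u, v} \<in> E"
  shows "dep v \<le> Suc (dep u)"
proof -
  obtain xs where xs: "walk V E xs" "hd xs = r" "last xs = u" "length xs = Suc (dep u)"
    using edge_verts[OF assms] shortest_walk by blast
  have "walk V E (xs @ tl [u, v])"
    using xs assms edge_verts[OF assms] by (intro walk_append_tl) (auto simp: walk_Cons_iff)
  then have "dep (last (xs @ [v])) \<le> length (xs @ [v]) - 1"
    using xs by (intro dep_le) (auto simp: walk_def)
  then show ?thesis using xs by simp
qed

lemma parent_exists:
  assumes "v \<in> V" "v \<noteq> r"
  shows "\<exists>u. {u, v} \<in> E \<and> dep v = Suc (dep u)"
proof -
  obtain xs where xs: "walk V E xs" "hd xs = r" "last xs = v" "length xs = Suc (dep v)"
    using assms shortest_walk by blast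
  define ys where "ys = butlast xs"
  have "dep v \<noteq> 0" using assms dep_eq_0 by blast
  then have ne: "ys \<noteq> []" using xs by (auto simp: ys_def butlast_conv_take)
  have "xs = ys @ [v]" using xs by (auto simp: ys_def walk_def)
  then have "walk V E ys" "{last ys, v} \<in> E" "hd ys = r" "length ys = dep v"
    using xs ne by (auto simp: walk_def successively_append_iff)
  then show ?thesis using dep_le[of ys] dep_edge_le[of "last ys" v] \<open>dep v \<noteq> 0\<close>
    by (intro exI[of _ "last ys"]) auto
qed

lemma descending_walk:
  assumes "v \<in> V"
  shows "\<exists>xs. walk V E xs \<and> hd xs = v \<and> last xs = r \<and> (\<forall>x\<in>set xs. x = v \<or> dep x < dep v)"
  using assms
proof (induction "dep v" arbitrary: v rule: less_induct)
  case less
  show ?case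
  proof (cases "v = r")
    case True
    then show ?thesis using root by (intro exI[of _ "[r]"]) (auto simp: walk_def)
  next
    case False
    then obtain u where u: "{u, v} \<in> E" "dep v = Suc (dep u)" using parent_exists less by blast
    then obtain xs where "walk V E xs" "hd xs = u" "last xs = r" "\<forall>x\<in>set xs. x = u \<or> dep x < dep u"
      using less.hyps[of u] edge_verts[OF u(1)] by auto
    moreover from this have "xs \<noteq> []" by (auto simp: walk_def)
    ultimately show ?thesis using u less.prems
      by (intro exI[of _ "v # xs"]) (auto simp: walk_Cons_iff insert_commute)
  qed
qed

text \<open>Two such neighbours are joined through the root by a walk that avoids \<open>v\<close>; together with \<open>v\<close>
it would contain a cycle.\<close>
lemma upper_neighbour_unique:
  assumes u: "{u, v} \<in> E" "dep u \<le> dep v" and w: "{w, v} \<in> E" "dep w \<le> dep v"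
  shows "u = w"
proof (rule ccontr)
  assume "u \<noteq> w"
  obtain xs where xs: "walk V E xs" "hd xs = u" "last xs = r" "\<forall>x\<in>set xs. x = u \<or> dep x < dep u"
    using descending_walk edge_verts u(1) by blast
  obtain ys where ys: "walk V E ys" "hd ys = w" "last ys = r" "\<forall>x\<in>set ys. x = w \<or> dep x < dep w"
    using descending_walk edge_verts w(1) by blast
  have ne: "xs \<noteq> []" "ys \<noteq> []" using xs ys by (auto simp: walk_def)
  let ?zs = "xs @ tl (rev ys)"
  have "walk V E ?zs" using xs ys ne by (intro walk_append_tl walk_rev) (auto simp: hd_rev)
  moreover have "hd ?zs = u" using ne xs by simp
  moreover have "last ?zs = w"
  proof (cases "tl (rev ys) = []")
    case True
    then have "length ys = 1" using ne by (metis length_rev length_Suc_conv list.collapse list.size(3) One_nat_def rev_is_Nil_conv)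
    then have "hd ys = last ys" by (cases ys) auto
    then show ?thesis using True xs ys by simp
  next
    case False
    then show ?thesis using ys ne by (simp add: last_tl last_rev)
  qed
  moreover have "v \<notin> set ?zs"
  proof -
    have "set (tl (rev ys)) \<subseteq> set ys" by (metis ne(2) list.set_sel(2) rev_is_Nil_conv set_rev subsetI)
    moreover have "v \<notin> set xs" "v \<notin> set ys"
      using xs(4) ys(4) u w edge_verts[OF u(1)] edge_verts[OF w(1)] by force+
    ultimately show ?thesis by auto
  qed
  ultimately obtain p where p: "walk V E p" "hd p = u" "last p = w" "distinct p" "v \<notin> set p"
    using walk_imp_path[of V E ?zs] by auto
  then have "p \<noteq> []" by (auto simp: walk_def)
  then have "length p \<ge> 2" using p \<open>u \<noteq> w\<close> by (cases p; cases "tl p") auto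
  then have "cycle V E (v # p)"
    using p u w \<open>p \<noteq> []\<close> edge_verts[OF u(1)] by (auto simp: cycle_def walk_Cons_iff insert_commute)
  then show False using tree by (auto simp: tree_def)
qed

lemma edge_dep:
  assumes "{u, v} \<in> E"
  shows "dep v = Suc (dep u) \<or> dep u = Suc (dep v)"
proof -
  have "dep u \<noteq> dep v"
  proof
    assume eq: "dep u = dep v"
    have "v \<noteq> r" using eq dep_root dep_eq_0 edge_verts[OF assms] by metis
    then obtain p where "{p, v} \<in> E" "dep v = Suc (dep p)" using parent_exists edge_verts assms by blast
    then show False using upper_neighbour_unique[of u v p] assms eq by auto
  qed
  then show ?thesis
    using dep_edge_le[OF assms] dep_edge_le[of v u] assms by (simp add: insert_commute) linarith
qed

lemma finite_children: "finite (children V E r v)"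
  using finite_V by (simp add: children_def)

lemma degree_nonroot:
  assumes "v \<in> V" "v \<noteq> r"
  shows "degree E v = Suc (card (children V E r v))"
proof -
  obtain p where p: "{p, v} \<in> E" "dep v = Suc (dep p)" using parent_exists assms by blast
  have "incident_edges E v = insert {p, v} ((\<lambda>u. {v, u}) ` children V E r v)"
  proof (intro equalityI subsetI)
    fix e assume e: "e \<in> incident_edges E v"
    then have "e \<in> E" "v \<in> e" by (auto simp: incident_edges_def)
    then have "\<exists>u. e = {v, u}" by (metis edge_obtain insertE insert_commute singletonD)
    then obtain u where u: "e = {v, u}" "{v, u} \<in> E" using \<open>e \<in> E\<close> by auto
    consider "dep u = Suc (dep v)" | "dep v = Suc (dep u)" using edge_dep u by blast
    then show "e \<in> insert {p, v} ((\<lambda>u. {v, u}) ` children V E r v)"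
    proof cases
      case 1
      then show ?thesis using u edge_verts by (auto simp: children_def)
    next
      case 2
      then have "u = p" using upper_neighbour_unique[of u v p] p u by (simp add: insert_commute)
      then show ?thesis using u by (simp add: insert_commute)
    qed
  qed (use p in \<open>auto simp: incident_edges_def children_def\<close>)
  moreover have "{p, v} \<notin> (\<lambda>u. {v, u}) ` children V E r v"
    using p by (auto simp: children_def doubleton_eq_iff)
  moreover have "inj_on (\<lambda>u. {v, u}) (children V E r v)"
    by (auto simp: inj_on_def doubleton_eq_iff)
  ultimately show ?thesis by (simp add: degree_def finite_children card_image)
qed

end

text \<open>The leaves are exactly the vertices at maximal depth. In particular the root is not a leaf,
since a vertex of maximal depth is a leaf of positive depth.\<close>
lemma complete_full_tree_height:
  assumes "3 \<le> t" "complete_full_tree t V E r" "E \<noteq> {}"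
  shows "\<exists>n\<ge>1. (\<forall>v\<in>V. depth V E r v \<le> n) \<and> leaves V E = {v \<in> V. depth V E r v = n} \<and>
     (\<forall>v\<in>V. depth V E r v < n \<longrightarrow> card (children V E r v) = t)"
proof -
  interpret rooted_tree V E r
    using assms by unfold_locales (auto simp: complete_full_tree_def)
  have inner: "card (children V E r v) = t" if "v \<in> V - leaves V E" for v
    using assms that by (auto simp: complete_full_tree_def)
  obtain n where n: "\<And>v. v \<in> leaves V E \<Longrightarrow> dep v = n"
    using assms by (auto simp: complete_full_tree_def)
  obtain a b where ab: "{a, b} \<in> E" using assms edge_obtain by (metis all_not_in_conv)
  have "Max (dep ` V) \<in> dep ` V" using finite_V root by (intro Max_in) auto
  then obtain z where "z \<in> V" "dep z = Max (dep ` V)" by auto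
  then have z: "z \<in> V" "\<And>v. v \<in> V \<Longrightarrow> dep v \<le> dep z" using finite_V by auto
  have "dep z \<ge> 1" using edge_dep[OF ab] edge_verts[OF ab] z by force
  then have "z \<noteq> r" using dep_root by auto
  have "children V E r z = {}"
    using z by (fastforce simp: children_def)
  then have "z \<in> leaves V E" using degree_nonroot[OF z(1) \<open>z \<noteq> r\<close>] z by (simp add: leaves_def)
  then have zn: "dep z = n" using n by simp
  have "v \<in> leaves V E" if "v \<in> V" "dep v = n" for v
  proof (rule ccontr)
    assume "v \<notin> leaves V E"
    then have "children V E r v \<noteq> {}" using inner that assms by fastforce
    then obtain u where "u \<in> children V E r v" by blast
    then have "u \<in> V" "dep u = Suc n" using that by (simp_all add: children_def)
    then show False using z zn by force
  qed
  then have "leaves V E = {v \<in> V. dep v = n}" using n by (auto simp: leaves_def)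
  then show ?thesis using zn z \<open>dep z \<ge> 1\<close> inner by (intro exI[of _ n]) auto
qed

text \<open>The vertex with a given code, where \<open>\<chi> v d\<close> is the child of \<open>v\<close> with index \<open>d\<close>.\<close>
primrec node :: "('a \<Rightarrow> int \<Rightarrow> 'a) \<Rightarrow> 'a \<Rightarrow> int list \<Rightarrow> 'a" where
  "node \<chi> r [] = r"
| "node \<chi> r (d # w) = \<chi> (node \<chi> r w) d"

text \<open>A tree of height \<open>n\<close> in which the children of every vertex above depth \<open>n\<close> are indexed
by \<open>{-h..h}\<close>.\<close>
locale coded_tree = rooted_tree V E r
  for V :: "'a set" and E r +
  fixes h :: int and n :: nat and \<chi> :: "'a \<Rightarrow> int \<Rightarrow> 'a"
  assumes h: "0 \<le> h"
    and dep_le_n: "\<And>v. v \<in> V \<Longrightarrow> dep v \<le> n"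
    and child_bij: "\<And>v. v \<in> V \<Longrightarrow> dep v < n \<Longrightarrow> bij_betw (\<chi> v) {-h..h} (children V E r v)"
begin

abbreviation "\<phi> \<equiv> node \<chi> r"

text \<open>The edge between a nonroot vertex and its parent, given by the code of the lower end.\<close>
definition edge :: "int list \<Rightarrow> 'a set" where
  "edge w = {\<phi> (tl w), \<phi> w}"

lemma node_Cons:
  assumes "d \<in> {-h..h}" "\<phi> w \<in> V" "dep (\<phi> w) < n"
  shows "\<phi> (d # w) \<in> V" "{\<phi> w, \<phi> (d # w)} \<in> E" "dep (\<phi> (d # w)) = Suc (dep (\<phi> w))"
  using bij_betw_apply[OF child_bij[OF assms(2,3)] assms(1)] by (auto simp: children_def)

lemma node_in: "w \<in> words h {0..n} \<Longrightarrow> \<phi> w \<in> V \<and> dep (\<phi> w) = length w"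
proof (induction w)
  case (Cons d w)
  then have "w \<in> words h {0..n}" "d \<in> {-h..h}" "length w < n" by (auto simp: words_def)
  then show ?case using Cons node_Cons[of d w] by auto
qed (simp add: root dep_root)

lemma node_inj: "v \<in> words h {0..n} \<Longrightarrow> w \<in> words h {0..n} \<Longrightarrow> \<phi> v = \<phi> w \<Longrightarrow> v = w"
proof (induction v arbitrary: w)
  case Nil
  then show ?case using node_in[of w] node_in[of "[]"] by simp
next
  case (Cons d v)
  have "length w = length (d # v)" using Cons.prems node_in[of w] node_in[of "d # v"] by metis
  then obtain d' w' where w: "w = d' # w'" by (cases w) auto
  have vw: "v \<in> words h {0..n}" "w' \<in> words h {0..n}" "d \<in> {-h..h}" "d' \<in> {-h..h}"
    "length v < n" "length w' < n"
    using Cons.prems w by (auto simp: words_def)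
  note v' = node_in[OF vw(1)] and w' = node_in[OF vw(2)]
  have "\<phi> v = \<phi> w'"
    using upper_neighbour_unique[of "\<phi> v" "\<phi> w" "\<phi> w'"] node_Cons[OF vw(3)] node_Cons[OF vw(4)]
      v' w' vw w Cons.prems(3) by (metis le_SucI order_refl)
  then have "v = w'" using Cons.IH vw by blast
  moreover have "d = d'"
  proof -
    have "inj_on (\<chi> (\<phi> v)) {-h..h}" using child_bij[of "\<phi> v"] v' vw by (simp add: bij_betw_def)
    then show ?thesis using Cons.prems(3) w \<open>v = w'\<close> vw by (auto dest: inj_onD)
  qed
  ultimately show ?case using w by simp
qed

lemma node_surj: "v \<in> V \<Longrightarrow> \<exists>w\<in>words h {0..n}. \<phi> w = v"
proof (induction "dep v" arbitrary: v rule: less_induct)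
  case less
  show ?case
  proof (cases "v = r")
    case True
    then show ?thesis by (intro bexI[of _ "[]"]) (auto simp: words_def)
  next
    case False
    then obtain u where u: "{u, v} \<in> E" "dep v = Suc (dep u)" using parent_exists less by blast
    then obtain w where w: "w \<in> words h {0..n}" "\<phi> w = u"
      using less.hyps[of u] edge_verts[OF u(1)] by auto
    have "dep u < n" using u dep_le_n[OF less.prems] by simp
    moreover have "v \<in> children V E r u" using u less.prems by (simp add: children_def)
    ultimately have "v \<in> \<chi> u ` {-h..h}"
      using child_bij[of u] edge_verts[OF u(1)] by (simp add: bij_betw_def)
    then obtain d where d: "d \<in> {-h..h}" "v = \<chi> u d" by blast
    then have "d # w \<in> words h {0..n}" using w \<open>dep u < n\<close> node_in[of w] by (auto simp: words_def)
    then show ?thesis using d w by (intro bexI[of _ "d # w"]) auto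
  qed
qed

lemma node_bij: "bij_betw \<phi> (words h {0..n}) V"
  using node_in node_inj node_surj by (fastforce simp: bij_betw_def inj_on_def)

lemma edge_iff:
  assumes "v \<in> words h {0..n}" "w \<in> words h {0..n}" "length w = Suc (length v)"
  shows "{\<phi> v, \<phi> w} \<in> E \<longleftrightarrow> v = tl w"
proof -
  obtain d u where w: "w = d # u" using assms by (cases w) auto
  have u: "u \<in> words h {0..n}" "d \<in> {-h..h}" "length u < n" using assms w by (auto simp: words_def)
  note uE = node_Cons[OF u(2), of u] node_in[OF u(1)]
  have "v = u" if "{\<phi> v, \<phi> w} \<in> E"
  proof -
    have "\<phi> v = \<phi> u"
      by (rule upper_neighbour_unique[of _ "\<phi> w"])
         (use that uE u w node_in assms in auto)
    then show ?thesis using node_inj assms u by blast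
  qed
  then show ?thesis using uE u w by auto
qed

lemma edge_bij: "bij_betw edge (words h {1..n}) E"
  unfolding bij_betw_def
proof (intro conjI equalityI subsetI)
  have tl: "tl w \<in> words h {0..n} \<and> w \<in> words h {0..n} \<and> length w = Suc (length (tl w))"
    if "w \<in> words h {1..n}" for w
    using that by (cases w) (auto simp: words_def)
  show "inj_on edge (words h {1..n})"
  proof (rule inj_onI)
    fix v w assume v: "v \<in> words h {1..n}" and w: "w \<in> words h {1..n}" and "edge v = edge w"
    then consider "\<phi> v = \<phi> w" | "\<phi> v = \<phi> (tl w)" "\<phi> (tl v) = \<phi> w"
      by (auto simp: edge_def doubleton_eq_iff)
    then show "v = w"
    proof cases
      case 1 then show ?thesis using tl[OF v] tl[OF w] node_inj by blast
    next
      case 2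
      then have "v = tl w" "tl v = w" using tl[OF v] tl[OF w] node_inj by blast+
      then show ?thesis using tl[OF v] tl[OF w] by (metis Suc_n_not_le_n le_SucI order_refl)
    qed
  qed
  show "e \<in> E" if "e \<in> edge ` words h {1..n}" for e
    using that tl edge_iff by (auto simp: edge_def)
  show "e \<in> edge ` words h {1..n}" if e: "e \<in> E" for e
  proof -
    have "\<exists>a b. e = {a, b} \<and> dep b = Suc (dep a)"
      using e edge_dep by (metis edge_obtain insert_commute)
    then obtain a b where ab: "e = {a, b}" "dep b = Suc (dep a)" by blast
    then obtain v w where vw: "v \<in> words h {0..n}" "w \<in> words h {0..n}" "\<phi> v = a" "\<phi> w = b"
      using node_surj edge_verts e by metis
    then have "length w = Suc (length v)" using ab node_in by metis
    then have "v = tl w" "w \<in> words h {1..n}" using edge_iff[OF vw(1,2)] vw ab e by (auto simp: words_def)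
    then show ?thesis using vw ab by (auto simp: edge_def)
  qed
qed

lemma vertex_sum_node:
  assumes w: "w \<in> words h {0..n}"
  shows "vertex_sum E f (\<phi> w) = word_sum h n (f \<circ> edge) w"
proof -
  let ?up = "if w = [] then {} else {w}"
  let ?down = "if length w < n then (\<lambda>d. d # w) ` {-h..h} else {}"
  have sub: "?up \<union> ?down \<subseteq> words h {1..n}" using w by (cases w) (auto simp: words_def)
  have "incident_edges E (\<phi> w) = edge ` (?up \<union> ?down)"
  proof (intro equalityI subsetI)
    fix e assume "e \<in> incident_edges E (\<phi> w)"
    then have e: "e \<in> E" "\<phi> w \<in> e" by (auto simp: incident_edges_def)
    then obtain v where v: "v \<in> words h {1..n}" "e = edge v" using edge_bij by (auto simp: bij_betw_def)
    then obtain d u where du: "v = d # u" "d \<in> {-h..h}" "u \<in> words h {0..n}" "length u < n" "v \<in> words h {0..n}"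
      by (cases v) (auto simp: words_def)
    have "w = v \<or> w = u" using e v du node_inj[OF w] by (auto simp: edge_def)
    then show "e \<in> edge ` (?up \<union> ?down)" using v du by auto
  next
    fix e assume "e \<in> edge ` (?up \<union> ?down)"
    then obtain v where v: "v \<in> ?up \<union> ?down" "e = edge v" by blast
    then have "e \<in> E" using sub edge_bij by (auto simp: bij_betw_def)
    moreover have "\<phi> w \<in> e" using v by (auto simp: edge_def split: if_splits)
    ultimately show "e \<in> incident_edges E (\<phi> w)" by (simp add: incident_edges_def)
  qed
  moreover have "inj_on edge (?up \<union> ?down)" using sub edge_bij by (meson bij_betw_def inj_on_subset)
  ultimately have "vertex_sum E f (\<phi> w) = sum (f \<circ> edge) (?up \<union> ?down)"
    by (simp add: vertex_sum_def sum.reindex del: image_Un)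
  also have "\<dots> = sum (f \<circ> edge) ?up + sum (f \<circ> edge) ?down"
    by (rule sum.union_disjoint) auto
  also have "sum (f \<circ> edge) ?down = (if length w < n then \<Sum>d\<in>{-h..h}. (f \<circ> edge) (d # w) else 0)"
    by (simp add: sum.reindex inj_on_def)
  finally show ?thesis by (simp add: word_sum_def)
qed

lemma vertex_sum_image:
  "vertex_sum E f ` V = word_sum h n (f \<circ> edge) ` words h {0..n}"
proof -
  have "V = \<phi> ` words h {0..n}" using node_bij by (simp add: bij_betw_def)
  then show ?thesis using vertex_sum_node by (simp add: image_image cong: image_cong)
qed

lemma local_antimagic_iff_words:
  "local_antimagic_labeling V E f \<longleftrightarrow>
     bij_betw (f \<circ> edge) (words h {1..n}) {1..card (words h {1..n})} \<and>
     (\<forall>w\<in>words h {0..<n}. \<forall>d\<in>{-h..h}.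
        word_sum h n (f \<circ> edge) w \<noteq> word_sum h n (f \<circ> edge) (d # w))"
proof -
  have "card E = card (words h {1..n})" using bij_betw_same_card[OF edge_bij] by simp
  moreover have "bij_betw f E B \<longleftrightarrow> bij_betw (f \<circ> edge) (words h {1..n}) B" for B
    using bij_betw_comp_iff[OF edge_bij] by blast
  moreover have "(\<forall>u\<in>V. \<forall>v\<in>V. {u, v} \<in> E \<longrightarrow> vertex_sum E f u \<noteq> vertex_sum E f v) \<longleftrightarrow>
    (\<forall>w\<in>words h {0..<n}. \<forall>d\<in>{-h..h}. vertex_sum E f (\<phi> w) \<noteq> vertex_sum E f (\<phi> (d # w)))"
  proof (intro iffI ballI impI)
    fix w d assume *: "\<forall>u\<in>V. \<forall>v\<in>V. {u, v} \<in> E \<longrightarrow> vertex_sum E f u \<noteq> vertex_sum E f v"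
      and w: "w \<in> words h {0..<n}" "d \<in> {-h..h}"
    then have "w \<in> words h {0..n}" "length w < n" by (auto simp: words_def)
    then show "vertex_sum E f (\<phi> w) \<noteq> vertex_sum E f (\<phi> (d # w))"
      using * node_in[of w] node_Cons[OF w(2), of w] by (metis (no_types))
  next
    fix u v assume *: "\<forall>w\<in>words h {0..<n}. \<forall>d\<in>{-h..h}. vertex_sum E f (\<phi> w) \<noteq> vertex_sum E f (\<phi> (d # w))"
      and uv: "{u, v} \<in> E"
    from uv obtain w where w: "w \<in> words h {1..n}" "{u, v} = edge w"
      using edge_bij by (auto simp: bij_betw_def)
    then obtain d x where "w = d # x" "d \<in> {-h..h}" "x \<in> words h {0..<n}"
      by (cases w) (auto simp: words_def)
    then show "vertex_sum E f u \<noteq> vertex_sum E f v"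
      using w * by (fastforce simp: edge_def doubleton_eq_iff)
  qed
  moreover have "w \<in> words h {0..n}" "d # w \<in> words h {0..n}"
    if "w \<in> words h {0..<n}" "d \<in> {-h..h}" for w d using that by (auto simp: words_def)
  ultimately show ?thesis
    unfolding local_antimagic_labeling_def using vertex_sum_node by (metis (no_types, lifting))
qed

end

section \<open>The number of colors\<close>

lemma word_labelling_exists:
  assumes "1 \<le> h" "1 \<le> n"
  shows "\<exists>lab :: int list \<Rightarrow> nat. bij_betw lab (words h {1..n}) {1..card (words h {1..n})} \<and>
    (\<exists>C. \<forall>w\<in>words h {0..<n}. word_sum h n lab w \<in> insert C (lab ` words h {n})) \<and>
    (\<forall>w\<in>words h {0..<n}. \<forall>d\<in>{-h..h}. word_sum h n lab w \<noteq> word_sum h n lab (d # w))"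
proof -
  let ?K = "card (words h {1..n})"
  obtain lab C where lab: "bij_betw lab (words h {1..n}) {1..int ?K}"
    and C: "\<forall>w\<in>words h {0..<n}. word_sum h n lab w \<in> insert C (lab ` words h {n})"
    and proper: "\<forall>w\<in>words h {0..<n}. \<forall>d\<in>{-h..h}. word_sum h n lab w \<noteq> word_sum h n lab (d # w)"
    using word_labelling_exists_int[OF assms] by blast
  have pos: "1 \<le> lab w" if "w \<in> words h {1..n}" for w
    using bij_betw_apply[OF lab that] by simp
  have sum_eq: "int (word_sum h n (nat \<circ> lab) w) = word_sum h n lab w" if w: "w \<in> words h {0..n}" for w
  proof -
    have "int (nat (lab w)) = lab w" if "w \<noteq> []"
      using pos[of w] w that by (cases w) (auto simp: words_def)
    moreover have "(\<Sum>d\<in>{-h..h}. int (nat (lab (d # w)))) = (\<Sum>d\<in>{-h..h}. lab (d # w))" if "length w < n"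
    proof (rule sum.cong)
      fix d assume "d \<in> {-h..h}"
      then have "d # w \<in> words h {1..n}" using w that by (auto simp: words_def)
      then show "int (nat (lab (d # w))) = lab (d # w)" using pos by fastforce
    qed simp
    ultimately show ?thesis by (simp add: word_sum_def)
  qed
  have "bij_betw nat {1..int ?K} {1..?K}"
    by (rule bij_betw_byWitness[where f' = int]) auto
  then have "bij_betw (nat \<circ> lab) (words h {1..n}) {1..?K}" using lab bij_betw_trans by blast
  moreover have "word_sum h n (nat \<circ> lab) w \<in> insert (nat C) ((nat \<circ> lab) ` words h {n})"
    if w: "w \<in> words h {0..<n}" for w
  proof -
    have "w \<in> words h {0..n}" using w by (auto simp: words_def)
    then have "word_sum h n (nat \<circ> lab) w = nat (word_sum h n lab w)" using sum_eq[of w] by simp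
    then show ?thesis using C w by (auto simp: image_comp[symmetric])
  qed
  moreover have "word_sum h n (nat \<circ> lab) w \<noteq> word_sum h n (nat \<circ> lab) (d # w)"
    if w: "w \<in> words h {0..<n}" "d \<in> {-h..h}" for w d
  proof -
    have "w \<in> words h {0..n}" "d # w \<in> words h {0..n}" using w by (auto simp: words_def)
    then show ?thesis using sum_eq proper w by (metis (no_types, lifting))
  qed
  ultimately show ?thesis by (intro exI[of _ "nat \<circ> lab"]) blast
qed

lemma word_sum_colours_le:
  assumes "\<forall>w\<in>words h {0..<n}. word_sum h n lab w \<in> insert C (lab ` words h {n})" and n: "1 \<le> n"
  shows "card (word_sum h n lab ` words h {0..n}) \<le> card (words h {n}) + 1"
proof -
  have "word_sum h n lab ` words h {0..n} \<subseteq> insert C (lab ` words h {n})"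
  proof safe
    fix w assume w: "w \<in> words h {0..n}" and "word_sum h n lab w \<notin> lab ` words h {n}"
    moreover have "length w \<noteq> n"
    proof
      assume "length w = n"
      then have "w \<in> words h {n}" "word_sum h n lab w = lab w"
        using w n by (auto simp: words_def word_sum_def)
      then show False using calculation(2) by simp
    qed
    ultimately show "word_sum h n lab w = C" using assms(1) w by (fastforce simp: words_def)
  qed
  then have "card (word_sum h n lab ` words h {0..n}) \<le> card (insert C (lab ` words h {n}))"
    by (intro card_mono) (auto simp: finite_words)
  also have "\<dots> \<le> card (lab ` words h {n}) + 1" by (simp add: card_insert_if finite_words)
  also have "\<dots> \<le> card (words h {n}) + 1" by (simp add: card_image_le finite_words)
  finally show ?thesis .
qed

text \<open>The leaf weights are distinct labels. The upper end of the edge with the largest label is not a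
leaf, and its weight exceeds all labels.\<close>
lemma word_sum_colours_ge:
  fixes lab :: "int list \<Rightarrow> nat"
  assumes bij: "bij_betw lab (words h {1..n}) {1..card (words h {1..n})}" and "1 \<le> h" "1 \<le> n"
  shows "card (words h {n}) + 1 \<le> card (word_sum h n lab ` words h {0..n})"
proof -
  let ?K = "card (words h {1..n})"
  have "replicate n 0 \<in> words h {1..n}" using assms by (auto simp: words_def)
  then have "?K \<ge> 1" using finite_words[of "{1..n}" h] by (metis One_nat_def Suc_leI card_gt_0_iff empty_iff finite_atLeastAtMost)
  then obtain w where w: "w \<in> words h {1..n}" "lab w = ?K"
    using bij by (metis (no_types, lifting) atLeastAtMost_iff bij_betw_def imageE order_refl)
  then obtain d v where dv: "w = d # v" "d \<in> {-h..h}" "v \<in> words h {0..n}" "length v < n"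
    by (cases w) (auto simp: words_def)
  obtain d' where d': "d' \<in> {-h..h}" "d' \<noteq> d"
    using assms(2) by (cases "d = 0") (auto intro: that[of 1] that[of 0])
  have "d' # v \<in> words h {1..n}" using dv d' by (auto simp: words_def)
  then have "1 \<le> lab (d' # v)" using bij_betw_apply[OF bij] by auto
  then have "?K < lab (d # v) + lab (d' # v)" using w dv by simp
  also have "\<dots> = (\<Sum>d\<in>{d, d'}. lab (d # v))" using d' by simp
  also have "\<dots> \<le> (\<Sum>d\<in>{-h..h}. lab (d # v))" by (rule sum_mono2) (use dv d' in auto)
  also have "\<dots> \<le> word_sum h n lab v" using dv by (simp add: word_sum_def)
  finally have big: "?K < word_sum h n lab v" .
  have sub: "words h {n} \<subseteq> words h {1..n}" using assms by (auto simp: words_def)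
  have "lab ` words h {n} \<subseteq> {1..?K}" using bij sub by (auto simp: bij_betw_def)
  then have "card (insert (word_sum h n lab v) (lab ` words h {n})) = card (lab ` words h {n}) + 1"
    using big by (subst card_insert_disjoint) (auto simp: finite_words)
  also have "card (lab ` words h {n}) = card (words h {n})"
    using bij sub by (meson bij_betw_def card_image inj_on_subset)
  finally have "card (words h {n}) + 1 = card (insert (word_sum h n lab v) (lab ` words h {n}))" by simp
  also have "\<dots> \<le> card (word_sum h n lab ` words h {0..n})"
  proof (rule card_mono)
    have "lab u = word_sum h n lab u" "u \<in> words h {0..n}" if "u \<in> words h {n}" for u
      using that assms by (auto simp: words_def word_sum_def)
    then show "insert (word_sum h n lab v) (lab ` words h {n}) \<subseteq> word_sum h n lab ` words h {0..n}"
      using dv by blast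
  qed (simp add: finite_words)
  finally show ?thesis .
qed

theorem theorem4p1:
  fixes t :: nat and V :: "'a set" and E :: "'a set set" and r :: 'a
  assumes "3 \<le> t" and "odd t"
    and "complete_full_tree t V E r"
    and "E \<noteq> {}"
  shows "chi_la V E = card (leaves V E) + 1"
proof -
  obtain n where n: "1 \<le> n" "\<forall>v\<in>V. depth V E r v \<le> n"
    and leaves: "leaves V E = {v \<in> V. depth V E r v = n}"
    and inner: "\<forall>v\<in>V. depth V E r v < n \<longrightarrow> card (children V E r v) = t"
    using complete_full_tree_height[OF assms(1,3,4)] by blast
  define h where "h = int (t div 2)"
  have h_pos: "1 \<le> h" "int t = 2 * h + 1" using assms(1,2) by (auto simp: h_def elim: oddE)
  have "\<exists>\<chi>. bij_betw \<chi> {-h..h} (children V E r v)" if "v \<in> V" "depth V E r v < n" for v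
  proof (rule finite_same_card_bij)
    have c: "card (children V E r v) = t" using inner that by blast
    then show "finite (children V E r v)" using assms(1) by (intro card_ge_0_finite) simp
    show "card {-h..h} = card (children V E r v)" using c h_pos by simp
  qed simp
  then obtain \<chi> where \<chi>:
    "\<And>v. v \<in> V \<Longrightarrow> depth V E r v < n \<Longrightarrow> bij_betw (\<chi> v) {-h..h} (children V E r v)"
    by metis
  interpret coded_tree V E r h n \<chi>
    using assms(3) h_pos n \<chi> by unfold_locales (auto simp: complete_full_tree_def)
  have card_leaves: "card (leaves V E) = card (words h {n})"
  proof -
    have "bij_betw \<phi> (words h {n}) (leaves V E)"
    proof (rule bij_betw_subset[OF node_bij])
      show "words h {n} \<subseteq> words h {0..n}" by (auto simp: words_def)
      show "\<phi> ` words h {n} = leaves V E"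
      proof (intro equalityI subsetI)
        fix v assume "v \<in> leaves V E"
        then obtain w where "w \<in> words h {0..n}" "\<phi> w = v" "dep v = n"
          using node_surj leaves by auto
        then show "v \<in> \<phi> ` words h {n}" using node_in[of w] by (auto simp: words_def)
      next
        fix v assume "v \<in> \<phi> ` words h {n}"
        then obtain w where "v = \<phi> w" "w \<in> words h {0..n}" "length w = n" by (auto simp: words_def)
        then show "v \<in> leaves V E" using node_in leaves by auto
      qed
    qed
    then show ?thesis by (simp add: bij_betw_same_card)
  qed
  obtain lab :: "int list \<Rightarrow> nat" and C
    where lab: "bij_betw lab (words h {1..n}) {1..card (words h {1..n})}"
    and colours: "\<forall>w\<in>words h {0..<n}. word_sum h n lab w \<in> insert C (lab ` words h {n})"
    and proper: "\<forall>w\<in>words h {0..<n}. \<forall>d\<in>{-h..h}. word_sum h n lab w \<noteq> word_sum h n lab (d # w)"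
    using word_labelling_exists[OF h_pos(1) n(1)] by blast
  define f where "f = lab \<circ> the_inv_into (words h {1..n}) edge"
  have f_edge: "(f \<circ> edge) w = lab w" if "w \<in> words h {1..n}" for w
    using that edge_bij by (simp add: f_def bij_betw_def the_inv_into_f_f)
  have ws: "word_sum h n (f \<circ> edge) w = word_sum h n lab w" if w: "w \<in> words h {0..n}" for w
  proof -
    have "w \<noteq> [] \<Longrightarrow> w \<in> words h {1..n}" using w by (cases w) (auto simp: words_def)
    moreover have "d # w \<in> words h {1..n}" if "d \<in> {-h..h}" "length w < n" for d
      using that w by (auto simp: words_def)
    ultimately show ?thesis
      unfolding word_sum_def using f_edge by (intro arg_cong2[of _ _ _ _ "(+)"]) (auto intro!: sum.cong)
  qed
  have "local_antimagic_labeling V E f"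
    unfolding local_antimagic_iff_words
  proof (intro conjI ballI)
    show "bij_betw (f \<circ> edge) (words h {1..n}) {1..card (words h {1..n})}"
      using lab f_edge bij_betw_cong by (metis (no_types, lifting))
  next
    fix w d assume wd: "w \<in> words h {0..<n}" "d \<in> {-h..h}"
    then have "w \<in> words h {0..n}" "d # w \<in> words h {0..n}" by (auto simp: words_def)
    then show "word_sum h n (f \<circ> edge) w \<noteq> word_sum h n (f \<circ> edge) (d # w)"
      using ws proper wd by simp
  qed
  moreover have "card (vertex_sum E f ` V) \<le> card (leaves V E) + 1"
  proof -
    have "vertex_sum E f ` V = word_sum h n lab ` words h {0..n}"
      unfolding vertex_sum_image using ws by (intro image_cong) auto
    then show ?thesis using word_sum_colours_le[OF colours n(1)] card_leaves by simp
  qed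
  moreover have ge: "card (leaves V E) + 1 \<le> card (vertex_sum E f' ` V)"
    if "local_antimagic_labeling V E f'" for f'
    using that word_sum_colours_ge[of "f' \<circ> edge" h n] h_pos n(1)
    unfolding local_antimagic_iff_words vertex_sum_image card_leaves by blast
  ultimately have "local_antimagic_labeling V E f \<and> card (vertex_sum E f ` V) = card (leaves V E) + 1"
    by (meson le_antisym)
  then show ?thesis
    unfolding chi_la_def by (intro Least_equality) (use ge in blast)+
qed

end
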